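(* Let $\alpha\in(1,2)$ and let $\varphi\in C_c^\infty((0,1))$ satisfy $\varphi\ge0$ and $\int_0^1\varphi(r)\,dr=1$. For $\delta\ge2$ and $\varepsilon\in(0,1)$ let $u_{\delta,\varepsilon}$ be the mollified kernel defined in the context. There exists $C=C(\alpha,\varphi)>0$ such that, for all $x\in\mathbb{R}$, $\delta\ge2$ and $\varepsilon\in(0,1)$, $$|u_{\delta,\varepsilon}'(x)|\le C\Big(|x|^{\alpha-2}\mathbf 1_{\{|x|>2\varepsilon\}}+\frac{\delta}{\varepsilon^{2-\alpha}\log\delta}\mathbf 1_{\{|x|\le2\varepsilon\}}\Big),$$ $$|u_{\delta,\varepsilon}'(x)|\,|x|\le C\Big(|x|^{\alpha-1}+\frac{\delta}{\log\delta}\varepsilon^{\alpha-1}\Big),$$ $$|u_{\delta,\varepsilon}''(x)|\le C\Big(|x|^{\alpha-3}\mathbf 1_{\{|x|>2\varepsilon\}}+\frac{\delta^2}{\varepsilon^{3-\alpha}\log\delta}\mathbf 1_{\{|x|\le2\varepsilon\}}\Big),$$ $$|u_{\delta,\varepsilon}''(x)|\,x^2\le C\Big(|x|^{\alpha-1}+\frac{\delta^2}{\log\delta}\varepsilon^{\alpha-1}\Big).$$ In particular, $$\|u_{\delta,\varepsilon}'\|_\infty\le C\frac{\delta}{\varepsilon^{2-\alpha}\log\delta},\qquad \|u_{\delta,\varepsilon}''\|_\infty\le C\frac{\delta^2}{\varepsilon^{3-\alpha}\log\delta}.$$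
   Context: For $\delta\ge2$, $\varepsilon\in(0,1)$ define, for $y\ne0$, $$\psi_{\delta,\varepsilon}(y)=\frac{1}{2|y|\log\delta}\,\varphi\Big(\frac{\log(\varepsilon/|y|)}{\log\delta}\Big),\qquad \psi_{\delta,\varepsilon}(0)=0$$ (with $\varphi$ extended by $0$ outside $(0,1)$), and $$u_{\delta,\varepsilon}(x)=\int_{\mathbb{R}}|x-y|^{\alpha-1}\psi_{\delta,\varepsilon}(y)\,dy,\qquad x\in\mathbb{R}.$$ $\|\cdot\|_\infty$ is the uniform norm on $\mathbb{R}$. Products with an indicator that vanishes are read as $0$. *)

theory Defs
  imports "HOL-Analysis.Analysis"
begin

definition smooth_on_open :: "(real \<Rightarrow> real) \<Rightarrow> real set \<Rightarrow> bool" where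
  "smooth_on_open f U \<longleftrightarrow> open U \<and> (\<forall>k. \<forall>x\<in>U. (deriv ^^ k) f differentiable at x)"

text \<open>
  The space of smooth functions with compact support in the open set \<open>U\<close>. An element is represented
  by its extension by zero to the real line: the support condition forces \<open>f\<close> to vanish outside \<open>U\<close>.
\<close>

definition test_functions :: "real set \<Rightarrow> (real \<Rightarrow> real) set" where
  "test_functions U =
     {f. smooth_on_open f U \<and> compact (closure {x. f x \<noteq> 0}) \<and> closure {x. f x \<noteq> 0} \<subseteq> U}"

definition mollifier :: "(real \<Rightarrow> real) \<Rightarrow> real \<Rightarrow> real \<Rightarrow> real \<Rightarrow> real" where
  "mollifier \<phi> \<delta> \<epsilon> y =
     (if y = 0 then 0 else 1 / (2 * \<bar>y\<bar> * ln \<delta>) * \<phi> (ln (\<epsilon> / \<bar>y\<bar>) / ln \<delta>))"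

definition mollified_kernel :: "real \<Rightarrow> (real \<Rightarrow> real) \<Rightarrow> real \<Rightarrow> real \<Rightarrow> real \<Rightarrow> real" where
  "mollified_kernel \<alpha> \<phi> \<delta> \<epsilon> x =
     (LINT y|lborel. \<bar>x - y\<bar> powr (\<alpha> - 1) * mollifier \<phi> \<delta> \<epsilon> y)"

text \<open>
  The uniform norm on the real line, with values in the extended reals: it is infinite on unbounded
  functions, so a finite upper bound includes boundedness.
\<close>

definition uniform_norm :: "(real \<Rightarrow> real) \<Rightarrow> ereal" where
  "uniform_norm f = (SUP x. ereal \<bar>f x\<bar>)"

end

theory Submission
  imports Defs
begin

text \<open>
  Put \<open>p = \<alpha> - 1\<close>, which lies between \<open>0\<close> and \<open>1\<close>. The mollified kernel is the convolution of the
  continuous function \<open>\<bar>z\<bar> powr p\<close> with the mollifier, which is smooth and supported where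
  \<open>\<epsilon> / \<delta> \<le> \<bar>y\<bar> \<le> \<epsilon>\<close>. Hence it is twice differentiable, with the derivatives falling on the mollifier.
  To estimate them, derivatives are moved back to the kernel by integration by parts. The kernel has an
  exceptional point at \<open>0\<close>, but its first derivative, of size \<open>\<bar>z\<bar> powr (p - 1)\<close>, is still integrable;
  so one derivative can always be moved, and a second one if \<open>z\<close> stays away from \<open>0\<close>.

  Three facts about the mollifier suffice: it is \<open>O(\<delta> / (\<epsilon> * ln \<delta>))\<close>, its derivative is
  \<open>O((\<delta> / \<epsilon>)\<^sup>2 / ln \<delta>)\<close>, and its mass is bounded, all uniformly in \<open>\<delta>\<close> and \<open>\<epsilon>\<close>
  (\<open>mollifier_scaled_bump\<close>). For \<open>\<bar>x\<bar> > 2 * \<epsilon>\<close> all points \<open>z\<close> that contribute satisfy \<open>\<bar>z\<bar> \<ge> \<bar>x\<bar> / 2\<close>, so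
  the kernel derivative can be taken out of the integral with its size at \<open>x\<close>, leaving the mass
  (\<open>convolution_powr_far_bound\<close>, \<open>convolution_powr_far_bound_second\<close>). For \<open>\<bar>x\<bar> \<le> 2 * \<epsilon>\<close> the supremum of the
  mollifier, or of its derivative for the second-order bound, is taken out instead, leaving the
  integral of the singular kernel over an interval of length of order \<open>\<epsilon>\<close>, which is of order \<open>\<epsilon> powr p\<close>
  (\<open>convolution_powr_near_bound\<close>). The weighted and uniform bounds follow from these two regimes
  (\<open>combine_near_far\<close>).
\<close>

section \<open>Derivatives of absolute powers\<close>

lemma eventually_sgn_eq:
  fixes z :: real
  assumes "z \<noteq> 0"
  shows "\<forall>\<^sub>F y in nhds z. sgn y = sgn z"
proof (cases "z > 0")
  case True
  then have "\<forall>\<^sub>F y in nhds z. y \<in> {0<..}" by (intro eventually_nhds_in_open) auto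
  then show ?thesis by eventually_elim (use True in auto)
next
  case False
  then have "\<forall>\<^sub>F y in nhds z. y \<in> {..<0}" using assms by (intro eventually_nhds_in_open) auto
  then show ?thesis by eventually_elim (use False assms in auto)
qed

lemma abs_has_derivative:
  fixes z :: real
  assumes "z \<noteq> 0"
  shows "(abs has_real_derivative sgn z) (at z)"
proof -
  have "\<forall>\<^sub>F y in nhds z. sgn z * y = \<bar>y\<bar>"
    using eventually_sgn_eq[OF assms] by eventually_elim (metis abs_sgn mult.commute)
  moreover have "((\<lambda>y. sgn z * y) has_real_derivative sgn z) (at z)"
    by (auto intro!: derivative_eq_intros)
  ultimately show ?thesis by (subst (asm) DERIV_cong_ev[OF refl _ refl]) auto
qed

lemma sgn_mult_has_derivative:
  fixes z :: real
  assumes "z \<noteq> 0" and "(f has_real_derivative D) (at z)"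
  shows "((\<lambda>y. sgn y * f y) has_real_derivative sgn z * D) (at z)"
proof -
  have "\<forall>\<^sub>F y in nhds z. sgn z * f y = sgn y * f y"
    using eventually_sgn_eq[OF assms(1)] by eventually_elim simp
  moreover have "((\<lambda>y. sgn z * f y) has_real_derivative sgn z * D) (at z)"
    by (intro DERIV_cmult assms)
  ultimately show ?thesis by (subst (asm) DERIV_cong_ev[OF refl _ refl]) auto
qed

lemma abs_powr_has_derivative:
  fixes p z :: real
  assumes "z \<noteq> 0"
  shows "((\<lambda>z. \<bar>z\<bar> powr p) has_real_derivative p * (sgn z * \<bar>z\<bar> powr (p - 1))) (at z)"
proof -
  have "((\<lambda>z. \<bar>z\<bar> powr p) has_real_derivative (p * \<bar>z\<bar> powr (p - 1)) * sgn z) (at z)"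
    using assms
    by (intro DERIV_chain2[where f = "\<lambda>t. t powr p" and g = abs] has_real_derivative_powr
        abs_has_derivative) auto
  then show ?thesis by (simp add: mult_ac)
qed

lemma sgn_abs_powr_has_derivative:
  fixes p z :: real
  assumes "z \<noteq> 0"
  shows "((\<lambda>z. sgn z * \<bar>z\<bar> powr p) has_real_derivative p * \<bar>z\<bar> powr (p - 1)) (at z)"
proof -
  have "sgn z * sgn z = 1" using assms by (simp add: sgn_if)
  then have "sgn z * (p * (sgn z * \<bar>z\<bar> powr (p - 1))) = p * \<bar>z\<bar> powr (p - 1)"
    by (metis mult.assoc mult.commute mult_1)
  then show ?thesis
    using sgn_mult_has_derivative[OF assms abs_powr_has_derivative[OF assms]] by metis
qed

lemma continuous_abs_powr: "0 < p \<Longrightarrow> continuous_on S (\<lambda>z::real. \<bar>z\<bar> powr p)"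
  by (intro continuous_on_powr') (auto intro!: continuous_intros)

section \<open>Convolution with a compactly supported smooth function\<close>

text \<open>
  The Henstock-Kurzweil integral gives access to the fundamental theorem of calculus with exceptional
  points and integrates derivatives without a separate integrability argument.
\<close>
definition convolution :: "(real \<Rightarrow> real) \<Rightarrow> (real \<Rightarrow> real) \<Rightarrow> real \<Rightarrow> real" where
  "convolution f g x = integral UNIV (\<lambda>z. f z * g (x - z))"

lemma convolution_eq_interval:
  assumes "\<And>y. y \<notin> {-e..e} \<Longrightarrow> g y = 0" and "a \<le> x - e" and "x + e \<le> b"
  shows "convolution f g x = integral {a..b} (\<lambda>z. f z * g (x - z))"
proof -
  have "f z * g (x - z) = (if z \<in> {a..b} then f z * g (x - z) else 0)" for z
    using assms(1)[of "x - z"] assms(2,3) by auto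
  then have "convolution f g x = integral UNIV (\<lambda>z. if z \<in> {a..b} then f z * g (x - z) else 0)"
    unfolding convolution_def by presburger
  then show ?thesis by (simp only: integral_restrict_UNIV)
qed

text \<open>
  Differentiation under the integral sign. For \<open>x\<close> in a unit neighbourhood all the integrands live on
  one common compact interval, where the derivative of the integrand is jointly continuous.
\<close>
lemma convolution_has_derivative:
  assumes f: "continuous_on UNIV f"
    and g: "\<And>y. (g has_real_derivative g' y) (at y)" and g': "continuous_on UNIV g'"
    and supp: "\<And>y. y \<notin> {-e..e} \<Longrightarrow> g y = 0" and supp': "\<And>y. y \<notin> {-e..e} \<Longrightarrow> g' y = 0"
  shows "(convolution f g has_real_derivative convolution f g' x) (at x)"
proof -
  define a b U where "a = x - 1 - e" and "b = x + 1 + e" and "U = {x - 1<..<x + 1}"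
  have gc: "continuous_on UNIV g"
    using g DERIV_continuous_on by (metis has_field_derivative_at_within)
  have "((\<lambda>x. integral (cbox a b) (\<lambda>z. f z * g (x - z))) has_real_derivative
      integral (cbox a b) (\<lambda>z. f z * g' (x - z))) (at x within U)"
  proof (rule leibniz_rule_field_derivative[where fx = "\<lambda>x z. f z * g' (x - z)"])
    show "((\<lambda>x. f t * g (x - t)) has_real_derivative f t * g' (y - t)) (at y within U)" for y t
      by (rule has_field_derivative_at_within) (rule derivative_eq_intros DERIV_chain2[OF g] refl | simp)+
    show "(\<lambda>z. f z * g (y - z)) integrable_on cbox a b" for y
      by (intro integrable_continuous continuous_intros continuous_on_subset[OF f]
        continuous_on_compose2[OF gc]) auto
    show "continuous_on (U \<times> cbox a b) (\<lambda>(y, t). f t * g' (y - t))"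
      unfolding case_prod_beta
      by (intro continuous_intros continuous_on_compose2[OF f]
        continuous_on_compose2[OF g']) auto
  qed (auto simp: U_def)
  then have *: "((\<lambda>x. integral {a..b} (\<lambda>z. f z * g (x - z))) has_real_derivative
      integral {a..b} (\<lambda>z. f z * g' (x - z))) (at x)"
    using at_within_open[of x U] by (simp add: U_def)
  have "convolution f g' x = integral {a..b} (\<lambda>z. f z * g' (x - z))"
    using supp' by (intro convolution_eq_interval[where e = e]) (auto simp: a_def b_def)
  moreover have "(convolution f g has_real_derivative integral {a..b} (\<lambda>z. f z * g' (x - z))) (at x)"
  proof (rule has_field_derivative_transform_within_open[OF *, of U])
    fix y assume "y \<in> U"
    then show "integral {a..b} (\<lambda>z. f z * g (y - z)) = convolution f g y"
      using supp by (intro convolution_eq_interval[where e = e, symmetric]) (auto simp: a_def b_def U_def)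
  qed (auto simp: U_def)
  ultimately show ?thesis by simp
qed

text \<open>
  The boundary terms contain the values of \<open>g\<close> that are assumed to be zero, so a derivative moves between the two factors without a sign
  change, the minus sign of integration by parts being absorbed by the reflection \<open>z \<mapsto> x - z\<close>. The
  fundamental theorem of calculus tolerates the one point \<open>0\<close> where \<open>f\<close> need only be continuous; this is
  what admits \<open>f z = \<bar>z\<bar> powr p\<close>, whose derivative is unbounded there.
\<close>
lemma has_integral_by_parts_reflected:
  fixes f g f' g' :: "real \<Rightarrow> real"
  assumes "a \<le> b" and f: "continuous_on {a..b} f"
    and f': "\<And>z. z \<in> {a..b} \<Longrightarrow> z \<noteq> 0 \<Longrightarrow> (f has_real_derivative f' z) (at z)"
    and g: "\<And>y. (g has_real_derivative g' y) (at y)" and g': "continuous_on UNIV g'"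
    and bd: "g (x - a) = 0" "g (x - b) = 0"
  shows "((\<lambda>z. f' z * g (x - z)) has_integral integral {a..b} (\<lambda>z. f z * g' (x - z))) {a..b}"
proof -
  have gc: "continuous_on UNIV g"
    using g DERIV_continuous_on by (metis has_field_derivative_at_within)
  let ?F = "\<lambda>z. f z * g (x - z)"
  have "((\<lambda>z. f' z * g (x - z) - f z * g' (x - z)) has_integral (?F b - ?F a)) {a..b}"
  proof (rule fundamental_theorem_of_calculus_interior_strong[where S = "{0}"])
    show "continuous_on {a..b} ?F"
      by (intro continuous_intros f continuous_on_compose2[OF gc]) auto
    fix z assume z: "z \<in> {a<..<b} - {0}"
    have "(?F has_real_derivative f' z * g (x - z) - f z * g' (x - z)) (at z)"
      using z by (auto intro!: derivative_eq_intros f' DERIV_chain2[OF g])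
    then show "(?F has_vector_derivative f' z * g (x - z) - f z * g' (x - z)) (at z)"
      by (simp add: has_real_derivative_iff_has_vector_derivative)
  qed (use assms in auto)
  moreover have "((\<lambda>z. f z * g' (x - z)) has_integral integral {a..b} (\<lambda>z. f z * g' (x - z))) {a..b}"
    by (intro integrable_integral integrable_continuous_interval continuous_intros f
        continuous_on_compose2[OF g']) auto
  ultimately have "((\<lambda>z. (f' z * g (x - z) - f z * g' (x - z)) + f z * g' (x - z))
      has_integral (?F b - ?F a) + integral {a..b} (\<lambda>z. f z * g' (x - z))) {a..b}"
    by (rule has_integral_add)
  then show ?thesis using bd by simp
qed

section \<open>Estimates for the power kernel\<close>

text \<open>
  The antiderivative is the odd power \<open>sgn z * \<bar>z\<bar> powr p\<close>, which is continuous at the singularity.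
\<close>
lemma abs_powr_has_integral:
  fixes p r :: real
  assumes "0 < p" "0 \<le> r"
  shows "((\<lambda>z. p * \<bar>z\<bar> powr (p - 1)) has_integral 2 * r powr p) {-r..r}"
proof -
  let ?F = "\<lambda>z. sgn z * \<bar>z\<bar> powr p"
  have "((\<lambda>z. p * \<bar>z\<bar> powr (p - 1)) has_integral (?F r - ?F (-r))) {-r..r}"
  proof (rule fundamental_theorem_of_calculus_interior_strong[where S = "{0}"])
    have "isCont ?F z" for z
    proof (cases "z = 0")
      case True
      have "((\<lambda>z. \<bar>z\<bar> powr p) \<longlongrightarrow> 0) (at (0::real))"
        using continuous_abs_powr[OF assms(1), of UNIV]
        unfolding continuous_on_def by (metis UNIV_I abs_zero powr_0)
      then have "(?F \<longlongrightarrow> 0) (at 0)"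
        by (rule Lim_null_comparison[rotated]) (auto simp: abs_mult abs_sgn_eq)
      then show ?thesis using True by (simp add: isCont_def)
    next
      case False
      then show ?thesis using sgn_abs_powr_has_derivative DERIV_isCont by blast
    qed
    then show "continuous_on {-r..r} ?F" by (simp add: continuous_at_imp_continuous_on)
    fix z assume "z \<in> {-r<..<r} - {0}"
    then show "(?F has_vector_derivative p * \<bar>z\<bar> powr (p - 1)) (at z)"
      using sgn_abs_powr_has_derivative[of z p] by (simp add: has_real_derivative_iff_has_vector_derivative)
  qed (use assms in auto)
  moreover have "?F r - ?F (-r) = 2 * r powr p" using assms by (cases "r = 0") auto
  ultimately show ?thesis by simp
qed

lemma has_integral_reflect_about:
  fixes h :: "real \<Rightarrow> real"
  assumes "(h has_integral I) {a..b}"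
  shows "((\<lambda>z. h (x - z)) has_integral I) {x - b..x - a}"
  using has_integral_affinity[of h I a b "-1" x] assms
  by (simp add: image_affinity_atLeastAtMost image_image)

text \<open>
  One derivative is moved from the bump to the kernel. For \<open>\<bar>x\<bar> \<le> 2 * e\<close> the support of
  \<open>\<lambda>z. g (x - z)\<close> lies in \<open>{-3 * e..3 * e}\<close>, so the integral is at most \<open>A\<close> times the integral of the
  absolute value of the kernel's derivative over that interval, which is \<open>2 * (3 * e) powr p\<close>.
  Used for \<open>g\<close> the mollifier and for \<open>g\<close> its derivative.
\<close>
lemma convolution_powr_near_bound:
  fixes p e A x :: real
  assumes p: "0 < p" "p < 1" and e: "0 < e"
    and g: "\<And>y. (g has_real_derivative g' y) (at y)" and g': "continuous_on UNIV g'"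
    and supp: "\<And>y. y \<notin> {-e<..<e} \<Longrightarrow> g y = 0" and supp': "\<And>y. y \<notin> {-e<..<e} \<Longrightarrow> g' y = 0"
    and A: "\<And>y. \<bar>g y\<bar> \<le> A" and x: "\<bar>x\<bar> \<le> 2 * e"
  shows "\<bar>convolution (\<lambda>z. \<bar>z\<bar> powr p) g' x\<bar> \<le> 6 * A * e powr p"
proof -
  let ?S = "{-(3 * e)..3 * e}"
  let ?k = "\<lambda>z. p * (sgn z * \<bar>z\<bar> powr (p - 1))"
  have "0 \<le> A" using A[of 0] by simp
  have "((\<lambda>z. ?k z * g (x - z)) has_integral integral ?S (\<lambda>z. \<bar>z\<bar> powr p * g' (x - z))) ?S"
    using e x by (intro has_integral_by_parts_reflected continuous_abs_powr p g g'
      abs_powr_has_derivative supp) auto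
  moreover have "integral ?S (\<lambda>z. \<bar>z\<bar> powr p * g' (x - z)) = convolution (\<lambda>z. \<bar>z\<bar> powr p) g' x"
    using x supp' by (intro convolution_eq_interval[where e = e, symmetric]) auto
  ultimately have J: "((\<lambda>z. ?k z * g (x - z)) has_integral convolution (\<lambda>z. \<bar>z\<bar> powr p) g' x) ?S"
    by simp
  have K: "((\<lambda>z. A * (p * \<bar>z\<bar> powr (p - 1))) has_integral A * (2 * (3 * e) powr p)) ?S"
    using e p by (intro has_integral_mult_right abs_powr_has_integral) auto
  have "norm (?k z * g (x - z)) \<le> A * (p * \<bar>z\<bar> powr (p - 1))" for z
  proof -
    have "\<bar>?k z\<bar> \<le> p * \<bar>z\<bar> powr (p - 1)" using p by (auto simp: abs_mult abs_sgn_eq)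
    then have "\<bar>?k z\<bar> * \<bar>g (x - z)\<bar> \<le> p * \<bar>z\<bar> powr (p - 1) * A"
      using p A by (intro mult_mono) auto
    then show ?thesis by (simp add: abs_mult mult_ac)
  qed
  then have "norm (integral ?S (\<lambda>z. ?k z * g (x - z))) \<le> integral ?S (\<lambda>z. A * (p * \<bar>z\<bar> powr (p - 1)))"
    using J K by (intro integral_norm_bound_integral) blast+
  then have "\<bar>convolution (\<lambda>z. \<bar>z\<bar> powr p) g' x\<bar> \<le> A * (2 * (3 * e) powr p)"
    unfolding integral_unique[OF J] integral_unique[OF K] by simp
  also have "(3 * e) powr p \<le> 3 * e powr p"
  proof -
    have "(3::real) powr p \<le> 3 powr 1" using p by (intro powr_mono) auto
    then show ?thesis using e by (auto simp: powr_mult intro!: mult_right_mono)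
  qed
  finally show ?thesis using \<open>0 \<le> A\<close> by (simp add: mult_left_mono)
qed

text \<open>
  The substitution \<open>z \<mapsto> x - z\<close> preserves integrals, so the mass of \<open>g\<close> enters with a bound that does not
  depend on \<open>x\<close>.
\<close>
lemma weighted_integral_bound:
  fixes f g :: "real \<Rightarrow> real"
  assumes I: "((\<lambda>z. f z * g (x - z)) has_integral I) {x - e..x + e}"
    and g: "continuous_on UNIV g" and M: "integral {-e..e} (\<lambda>y. \<bar>g y\<bar>) \<le> M"
    and N: "0 \<le> N" "\<And>z. z \<in> {x - e..x + e} \<Longrightarrow> \<bar>f z\<bar> \<le> N"
  shows "\<bar>I\<bar> \<le> N * M"
proof -
  have "((\<lambda>y. \<bar>g y\<bar>) has_integral integral {-e..e} (\<lambda>y. \<bar>g y\<bar>)) {-e..e}"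
    by (intro integrable_integral integrable_continuous_interval continuous_intros
      continuous_on_subset[OF g]) auto
  then have "((\<lambda>z. \<bar>g (x - z)\<bar>) has_integral integral {-e..e} (\<lambda>y. \<bar>g y\<bar>)) {x - e..x - -e}"
    by (rule has_integral_reflect_about)
  then have J: "((\<lambda>z. N * \<bar>g (x - z)\<bar>) has_integral N * integral {-e..e} (\<lambda>y. \<bar>g y\<bar>)) {x - e..x + e}"
    by (intro has_integral_mult_right) simp
  have "norm (integral {x - e..x + e} (\<lambda>z. f z * g (x - z)))
      \<le> integral {x - e..x + e} (\<lambda>z. N * \<bar>g (x - z)\<bar>)"
    using I J N by (intro integral_norm_bound_integral) (auto simp: abs_mult intro!: mult_right_mono)
  then have "\<bar>I\<bar> \<le> N * integral {-e..e} (\<lambda>y. \<bar>g y\<bar>)"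
    unfolding integral_unique[OF I] integral_unique[OF J] by simp
  also have "\<dots> \<le> N * M" using M N by (intro mult_left_mono)
  finally show ?thesis .
qed

text \<open>
  Outside \<open>{-2 * e..2 * e}\<close> the translate of the support of the bump stays at distance at least
  \<open>\<bar>x\<bar> / 2\<close> from the origin, so the singular kernels are comparable with their value at \<open>x\<close>.
  The cases \<open>m = 1\<close> and \<open>m = 2\<close> give the constants \<open>2\<close> and \<open>4\<close> of the two bounds far from the origin.
\<close>
lemma powr_away_from_zero_bound:
  fixes q e x z :: real
  assumes "0 \<le> q" and "q \<le> real m" and "0 < e" "2 * e < \<bar>x\<bar>" "z \<in> {x - e..x + e}"
  shows "\<bar>z\<bar> powr (-q) \<le> 2 ^ m * \<bar>x\<bar> powr (-q)"
proof -
  have "\<bar>x\<bar> / 2 \<le> \<bar>z\<bar>" "0 < \<bar>x\<bar> / 2" using assms by auto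
  then have "\<bar>z\<bar> powr (-q) \<le> (\<bar>x\<bar> / 2) powr (-q)" using assms by (intro powr_mono2') auto
  also have "\<dots> = 2 powr q * \<bar>x\<bar> powr (-q)" by (simp add: powr_divide powr_minus_divide)
  also have "2 powr q \<le> 2 powr (real m)" using assms by (intro powr_mono) auto
  finally show ?thesis by (simp add: powr_realpow mult_right_mono)
qed

lemma convolution_powr_far_bound:
  fixes p e x :: real
  assumes p: "0 < p" "p < 1" and e: "0 < e"
    and g: "\<And>y. (g has_real_derivative g' y) (at y)" and g': "continuous_on UNIV g'"
    and supp: "\<And>y. y \<notin> {-e<..<e} \<Longrightarrow> g y = 0" and supp': "\<And>y. y \<notin> {-e<..<e} \<Longrightarrow> g' y = 0"
    and M: "integral {-e..e} (\<lambda>y. \<bar>g y\<bar>) \<le> M" and x: "2 * e < \<bar>x\<bar>"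
  shows "\<bar>convolution (\<lambda>z. \<bar>z\<bar> powr p) g' x\<bar> \<le> 2 * M * \<bar>x\<bar> powr (p - 1)"
proof -
  let ?S = "{x - e..x + e}"
  let ?k = "\<lambda>z. p * (sgn z * \<bar>z\<bar> powr (p - 1))"
  have "((\<lambda>z. ?k z * g (x - z)) has_integral integral ?S (\<lambda>z. \<bar>z\<bar> powr p * g' (x - z))) ?S"
    using e by (intro has_integral_by_parts_reflected continuous_abs_powr p g g'
      abs_powr_has_derivative supp) auto
  moreover have "integral ?S (\<lambda>z. \<bar>z\<bar> powr p * g' (x - z)) = convolution (\<lambda>z. \<bar>z\<bar> powr p) g' x"
    using supp' by (intro convolution_eq_interval[where e = e, symmetric]) auto
  ultimately have J: "((\<lambda>z. ?k z * g (x - z)) has_integral convolution (\<lambda>z. \<bar>z\<bar> powr p) g' x) ?S"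
    by simp
  have "\<bar>convolution (\<lambda>z. \<bar>z\<bar> powr p) g' x\<bar> \<le> (2 * \<bar>x\<bar> powr (p - 1)) * M"
  proof (rule weighted_integral_bound[OF J _ M])
    show "continuous_on UNIV g"
      using g DERIV_continuous_on by (metis has_field_derivative_at_within)
    fix z assume z: "z \<in> ?S"
    have "\<bar>?k z\<bar> \<le> 1 * \<bar>z\<bar> powr (p - 1)"
      using p by (auto simp: abs_mult abs_sgn_eq intro!: mult_right_mono)
    also have "\<dots> \<le> 2 * \<bar>x\<bar> powr (p - 1)"
      using powr_away_from_zero_bound[of "1 - p" 1 e x z] p e x z by simp
    finally show "\<bar>?k z\<bar> \<le> 2 * \<bar>x\<bar> powr (p - 1)" .
  qed auto
  then show ?thesis by (simp add: mult_ac)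
qed

text \<open>
  Far from the origin both derivatives can be moved to the kernel: after the first integration by parts
  the kernel is \<open>p * (sgn z * \<bar>z\<bar> powr (p - 1))\<close>, which is smooth on the interval of integration because
  that interval does not contain \<open>0\<close>. This costs only the mass of \<open>g\<close> and no supremum of a derivative.
\<close>
lemma convolution_powr_far_bound_second:
  fixes p e x :: real
  assumes p: "0 < p" "p < 1" and e: "0 < e"
    and g: "\<And>y. (g has_real_derivative g' y) (at y)"
    and g': "\<And>y. (g' has_real_derivative g'' y) (at y)" and g'': "continuous_on UNIV g''"
    and supp: "\<And>y. y \<notin> {-e<..<e} \<Longrightarrow> g y = 0" and supp': "\<And>y. y \<notin> {-e<..<e} \<Longrightarrow> g' y = 0"
    and supp'': "\<And>y. y \<notin> {-e<..<e} \<Longrightarrow> g'' y = 0"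
    and M: "integral {-e..e} (\<lambda>y. \<bar>g y\<bar>) \<le> M" and x: "2 * e < \<bar>x\<bar>"
  shows "\<bar>convolution (\<lambda>z. \<bar>z\<bar> powr p) g'' x\<bar> \<le> 4 * M * \<bar>x\<bar> powr (p - 2)"
proof -
  let ?S = "{x - e..x + e}"
  let ?k = "\<lambda>z. p * (sgn z * \<bar>z\<bar> powr (p - 1))"
  let ?k' = "\<lambda>z. p * ((p - 1) * \<bar>z\<bar> powr (p - 1 - 1))"
  have S0: "z \<noteq> 0" if "z \<in> ?S" for z using that x e by auto
  have k: "(?k has_real_derivative ?k' z) (at z)" if "z \<noteq> 0" for z
    using that by (intro DERIV_cmult sgn_abs_powr_has_derivative)
  have kc: "continuous_on ?S ?k"
    using k S0 by (meson DERIV_isCont continuous_at_imp_continuous_on)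
  have gc: "continuous_on UNIV g" and gc': "continuous_on UNIV g'"
    using g g' DERIV_continuous_on by (metis has_field_derivative_at_within)+
  have I: "((\<lambda>z. ?k' z * g (x - z)) has_integral integral ?S (\<lambda>z. ?k z * g' (x - z))) ?S"
    using e by (intro has_integral_by_parts_reflected kc k g gc' supp) auto
  have "((\<lambda>z. ?k z * g' (x - z)) has_integral integral ?S (\<lambda>z. \<bar>z\<bar> powr p * g'' (x - z))) ?S"
    using e by (intro has_integral_by_parts_reflected continuous_abs_powr p g' g''
      abs_powr_has_derivative supp') auto
  then have "integral ?S (\<lambda>z. ?k z * g' (x - z)) = integral ?S (\<lambda>z. \<bar>z\<bar> powr p * g'' (x - z))"
    by (rule integral_unique)
  also have "\<dots> = convolution (\<lambda>z. \<bar>z\<bar> powr p) g'' x"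
    using supp'' by (intro convolution_eq_interval[where e = e, symmetric]) auto
  finally have J: "((\<lambda>z. ?k' z * g (x - z)) has_integral convolution (\<lambda>z. \<bar>z\<bar> powr p) g'' x) ?S"
    using I by simp
  have "\<bar>convolution (\<lambda>z. \<bar>z\<bar> powr p) g'' x\<bar> \<le> (4 * \<bar>x\<bar> powr (p - 2)) * M"
  proof (rule weighted_integral_bound[OF J gc M])
    fix z assume z: "z \<in> ?S"
    have "p * (1 - p) \<le> 1 * 1" using p by (intro mult_mono) auto
    then have "p * (1 - p) * \<bar>z\<bar> powr (p - 2) \<le> 1 * \<bar>z\<bar> powr (p - 2)"
      by (intro mult_right_mono) auto
    moreover have "\<bar>?k' z\<bar> = p * (1 - p) * \<bar>z\<bar> powr (p - 2)"
      using p by (simp add: abs_mult)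
    ultimately have "\<bar>?k' z\<bar> \<le> \<bar>z\<bar> powr (p - 2)" by simp
    also have "\<dots> \<le> 4 * \<bar>x\<bar> powr (p - 2)"
      using powr_away_from_zero_bound[of "2 - p" 2 e x z] p e x z by simp
    finally show "\<bar>?k' z\<bar> \<le> 4 * \<bar>x\<bar> powr (p - 2)" .
  qed auto
  then show ?thesis by (simp add: mult_ac)
qed

section \<open>Test functions on the line\<close>

text \<open>
  The definition of test functions speaks about derivatives inside \<open>U\<close> only. Since the complement of
  the closed support is open and the function vanishes on it, all derivatives exist and vanish there as
  well, so a test function is smooth on the whole line.
\<close>
lemma test_function_iterated_deriv_zero:
  assumes "\<phi> \<in> test_functions U" and "x \<notin> closure {x. \<phi> x \<noteq> 0}"
  shows "(deriv ^^ k) \<phi> x = 0" and "((deriv ^^ k) \<phi> has_real_derivative 0) (at x)"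
proof -
  define W where "W = - closure {x. \<phi> x \<noteq> 0}"
  have W: "open W" "x \<in> W" using assms by (auto simp: W_def)
  have z: "\<forall>y\<in>W. (deriv ^^ k) \<phi> y = 0" for k
  proof (induction k)
    case 0
    then show ?case using closure_subset by (force simp: W_def)
  next
    case (Suc k)
    have "((deriv ^^ k) \<phi> has_real_derivative 0) (at y)" if "y \<in> W" for y
      by (rule has_field_derivative_transform_within_open[of "\<lambda>_. 0" _ _ W]) (use Suc W that in auto)
    then show ?case by (auto intro: DERIV_imp_deriv)
  qed
  show "(deriv ^^ k) \<phi> x = 0" using z W by blast
  show "((deriv ^^ k) \<phi> has_real_derivative 0) (at x)"
    by (rule has_field_derivative_transform_within_open[of "\<lambda>_. 0" _ _ W]) (use z W in auto)
qed

lemma test_function_has_derivatives: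
  assumes "\<phi> \<in> test_functions U"
  shows "((deriv ^^ k) \<phi> has_real_derivative (deriv ^^ Suc k) \<phi> x) (at x)"
proof (cases "x \<in> U")
  case True
  then have "(deriv ^^ k) \<phi> differentiable at x"
    using assms by (auto simp: test_functions_def smooth_on_open_def)
  then show ?thesis by (simp add: DERIV_deriv_iff_real_differentiable)
next
  case False
  then have "x \<notin> closure {x. \<phi> x \<noteq> 0}" using assms by (auto simp: test_functions_def)
  then show ?thesis
    using test_function_iterated_deriv_zero[OF assms, of x] by metis
qed

lemma test_function_vanishes:
  assumes "\<phi> \<in> test_functions U" and "x \<notin> U"
  shows "(deriv ^^ k) \<phi> x = 0"
  using assms by (intro test_function_iterated_deriv_zero) (auto simp: test_functions_def)

lemma test_function_bounded:
  assumes "\<phi> \<in> test_functions {0<..<1}"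
  obtains M where "\<And>x. \<bar>(deriv ^^ k) \<phi> x\<bar> \<le> M"
proof -
  have "continuous_on {0..1} ((deriv ^^ k) \<phi>)"
    using test_function_has_derivatives[OF assms]
    by (meson DERIV_isCont continuous_at_imp_continuous_on)
  then have "bounded ((deriv ^^ k) \<phi> ` {0..1})"
    by (intro compact_imp_bounded compact_continuous_image) auto
  then obtain M where M: "\<And>x. x \<in> {0..1} \<Longrightarrow> \<bar>(deriv ^^ k) \<phi> x\<bar> \<le> M"
    unfolding bounded_iff by (metis imageI real_norm_def)
  have "\<bar>(deriv ^^ k) \<phi> x\<bar> \<le> M" for x
    using M[of x] M[of 0] test_function_vanishes[OF assms, of x k] by (cases "x \<in> {0<..<1}") auto
  then show ?thesis using that by blast
qed

section \<open>Logarithmic profiles and the mollifier\<close>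

text \<open>
  The mollifier has \<open>k = 1\<close>, as \<open>sgn y / y = 1 / \<bar>y\<bar>\<close>. The factor \<open>sgn y / y ^ k\<close> is chosen because it
  makes the family closed under differentiation on both half-lines at once: \<open>k\<close> goes up by one and
  \<open>h\<close> is replaced by \<open>- (k * h + h' / ln d)\<close>. The value at \<open>0\<close> is \<open>0\<close> since \<open>sgn 0 = 0\<close>.
\<close>
definition log_profile :: "real \<Rightarrow> real \<Rightarrow> (real \<Rightarrow> real) \<Rightarrow> nat \<Rightarrow> real \<Rightarrow> real" where
  "log_profile d e h k y = sgn y / y ^ k * h (ln (e / \<bar>y\<bar>) / ln d)"

text \<open>
  The argument of \<open>h\<close> is at least \<open>1\<close> for \<open>\<bar>y\<bar> \<le> e / d\<close> and at most \<open>0\<close> for \<open>\<bar>y\<bar> \<ge> e\<close>.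
\<close>
lemma log_profile_vanishes:
  fixes d e y :: real
  assumes d: "1 < d" and e: "0 < e" and h: "\<And>r. r \<notin> {0<..<1} \<Longrightarrow> h r = 0"
    and y: "\<bar>y\<bar> \<le> e / d \<or> e \<le> \<bar>y\<bar>"
  shows "log_profile d e h k y = 0"
proof (cases "y = 0")
  case False
  have "ln (e / \<bar>y\<bar>) / ln d \<notin> {0<..<1}"
  proof (cases "e \<le> \<bar>y\<bar>")
    case True
    then have "ln (e / \<bar>y\<bar>) \<le> 0" using e by (intro ln_le_zero_iff[THEN iffD2]) auto
    then show ?thesis using d by (auto simp: zero_less_divide_iff)
  next
    case c: False
    then have "d \<le> e / \<bar>y\<bar>" using y d False by (auto simp: field_simps)
    then have "ln d \<le> ln (e / \<bar>y\<bar>)" using d by simp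
    then show ?thesis using d by (auto simp: divide_less_eq)
  qed
  then show ?thesis by (simp add: log_profile_def h)
qed (simp add: log_profile_def)

text \<open>
  At \<open>0\<close> the profile vanishes in a neighbourhood. Elsewhere the sign is locally constant, and the inner
  function \<open>ln (e / \<bar>y\<bar>) / ln d\<close> has derivative \<open>- 1 / (y * ln d)\<close> on both half-lines.
\<close>
lemma log_profile_has_derivative:
  fixes d e y :: real
  assumes d: "1 < d" and e: "0 < e" and h: "\<And>r. (h has_real_derivative h' r) (at r)"
    and supp: "\<And>r. r \<notin> {0<..<1} \<Longrightarrow> h r = 0"
  shows "(log_profile d e h k has_real_derivative
    log_profile d e (\<lambda>r. - (k * h r + h' r / ln d)) (Suc k) y) (at y)"
proof (cases "y = 0")
  case True
  have "(log_profile d e h k has_real_derivative 0) (at 0)"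
  proof (rule has_field_derivative_transform_within_open[of "\<lambda>_. 0" _ _ "{-(e/d)<..<e/d}"])
    fix w assume "w \<in> {-(e/d)<..<e/d}"
    then have "\<bar>w\<bar> \<le> e / d" by auto
    then show "0 = log_profile d e h k w"
      by (intro log_profile_vanishes[symmetric] d e supp disjI1)
  qed (use d e in auto)
  then show ?thesis using True by (simp add: log_profile_def)
next
  case False
  have L: "ln d > 0" using d by simp
  have sy: "sgn y / \<bar>y\<bar> = 1 / y" using False by (auto simp: sgn_if)
  have "((\<lambda>w. ln \<bar>w\<bar>) has_real_derivative 1 / \<bar>y\<bar> * sgn y) (at y)"
    by (intro DERIV_chain2[where f = ln and g = abs] DERIV_ln_divide abs_has_derivative)
      (use False in auto)
  then have "((\<lambda>w. ln \<bar>w\<bar>) has_real_derivative 1 / y) (at y)" using sy by simp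
  then have "((\<lambda>w. (ln e - ln \<bar>w\<bar>) / ln d) has_real_derivative (0 - 1 / y) / ln d) (at y)"
    by (intro DERIV_cdivide DERIV_diff DERIV_const)
  moreover have "\<forall>\<^sub>F w in nhds y. (ln e - ln \<bar>w\<bar>) / ln d = ln (e / \<bar>w\<bar>) / ln d"
  proof -
    have "\<forall>\<^sub>F w in nhds y. w \<in> - {0}" using False by (intro eventually_nhds_in_open) auto
    then show ?thesis by eventually_elim (use e in \<open>auto simp: ln_div\<close>)
  qed
  ultimately have r: "((\<lambda>w. ln (e / \<bar>w\<bar>) / ln d) has_real_derivative - (1 / y) / ln d) (at y)"
    by (subst (asm) DERIV_cong_ev[OF refl _ refl]) auto
  let ?r = "ln (e / \<bar>y\<bar>) / ln d"
  have p: "((\<lambda>w. 1 / w ^ k) has_real_derivative - (k / y ^ Suc k)) (at y)"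
  proof (cases k)
    case (Suc m)
    have "((\<lambda>w. 1 / w ^ k) has_real_derivative (0 * y ^ k - 1 * (k * (1 * y ^ (k - Suc 0)))) / (y ^ k * y ^ k)) (at y)"
      using False by (intro DERIV_divide DERIV_const DERIV_power DERIV_ident) auto
    moreover have "(0 * y ^ k - 1 * (k * (1 * y ^ (k - Suc 0)))) / (y ^ k * y ^ k) = - (k / y ^ Suc k)"
      using False Suc by (simp add: divide_simps)
    ultimately show ?thesis by simp
  qed simp
  have "((\<lambda>w. sgn w * (1 / w ^ k * h (ln (e / \<bar>w\<bar>) / ln d))) has_real_derivative
      sgn y * (- (k / y ^ Suc k) * h ?r + h' ?r * (- (1 / y) / ln d) * (1 / y ^ k))) (at y)"
    by (intro sgn_mult_has_derivative False DERIV_mult p DERIV_chain2[OF h r])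
  moreover have "sgn y * (- (k / y ^ Suc k) * h ?r + h' ?r * (- (1 / y) / ln d) * (1 / y ^ k))
      = log_profile d e (\<lambda>r. - (k * h r + h' r / ln d)) (Suc k) y"
    unfolding log_profile_def using False L by (simp add: divide_simps) (simp add: algebra_simps)
  moreover have "(\<lambda>w. sgn w * (1 / w ^ k * h (ln (e / \<bar>w\<bar>) / ln d))) = log_profile d e h k"
    by (auto simp: log_profile_def)
  ultimately show ?thesis by simp
qed

text \<open>
  The profile lives where \<open>\<bar>y\<bar> \<ge> e / d\<close>, so each power of \<open>1 / \<bar>y\<bar>\<close> costs at most \<open>d / e\<close>.
\<close>
lemma log_profile_bound:
  fixes d e y :: real
  assumes d: "1 < d" and e: "0 < e" and N: "\<And>r. \<bar>h r\<bar> \<le> N"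
    and supp: "\<And>r. r \<notin> {0<..<1} \<Longrightarrow> h r = 0"
  shows "\<bar>log_profile d e h k y\<bar> \<le> N * (d / e) ^ k"
proof (cases "\<bar>y\<bar> \<le> e / d")
  case True
  then have "log_profile d e h k y = 0" by (intro log_profile_vanishes d e supp) auto
  moreover have "0 \<le> N" using N[of 0] by simp
  ultimately show ?thesis using d e by simp
next
  case False
  have "0 < e / d" using d e by simp
  then have "0 < \<bar>y\<bar>" using False by linarith
  then have y: "1 / \<bar>y\<bar> \<le> d / e" using False d e by (auto simp: field_simps)
  have "\<bar>log_profile d e h k y\<bar> = \<bar>h (ln (e / \<bar>y\<bar>) / ln d)\<bar> * (1 / \<bar>y\<bar>) ^ k"
    using \<open>0 < \<bar>y\<bar>\<close> by (simp add: log_profile_def abs_mult abs_sgn_eq power_abs power_divide)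
  also have "\<dots> \<le> N * (d / e) ^ k"
    using N[of 0] y by (intro mult_mono N power_mono) auto
  finally show ?thesis .
qed

text \<open>
  The integral of \<open>1 / y\<close> over \<open>{e / d..e}\<close> is exactly \<open>ln d\<close>, independently of \<open>e\<close>. This compensates the
  factor \<open>1 / ln d\<close> of the mollifier and bounds its mass uniformly in \<open>d\<close> and \<open>e\<close>.
\<close>
lemma log_profile_mass:
  fixes d e :: real
  assumes d: "1 < d" and e: "0 < e" and N: "\<And>r. \<bar>h r\<bar> \<le> N"
    and supp: "\<And>r. r \<notin> {0<..<1} \<Longrightarrow> h r = 0" and cont: "continuous_on UNIV (log_profile d e h 1)"
  shows "integral {-e..e} (\<lambda>y. \<bar>log_profile d e h 1 y\<bar>) \<le> 2 * N * ln d"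
proof -
  let ?f = "\<lambda>y. \<bar>log_profile d e h 1 y\<bar>"
  have ed: "0 < e / d" "e / d \<le> e" using d e by (auto simp: field_simps)
  have int: "?f integrable_on {a..b}" for a b
    by (intro integrable_continuous_interval continuous_intros continuous_on_subset[OF cont]) auto
  have even: "?f (- y) = ?f y" for y by (simp add: log_profile_def)
  have "integral {-e..-0} (\<lambda>y. ?f (- y)) = integral {0..e} ?f"
    by (rule Henstock_Kurzweil_Integration.integral_reflect_real)
  then have "integral {-e..0} ?f = integral {0..e} ?f" unfolding even by simp
  then have "integral {-e..e} ?f = 2 * integral {0..e} ?f"
    using Henstock_Kurzweil_Integration.integral_combine[of "-e" 0 e ?f] int e by simp
  also have "integral {0..e} ?f = integral {0..e/d} ?f + integral {e/d..e} ?f"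
    using Henstock_Kurzweil_Integration.integral_combine[of 0 "e/d" e ?f] int ed by simp
  also have "integral {0..e/d} ?f = integral {0..e/d} (\<lambda>_. 0)"
    by (intro integral_cong) (use d e in \<open>auto intro!: log_profile_vanishes supp\<close>)
  also have "integral {e/d..e} ?f \<le> N * ln d"
  proof -
    have "((\<lambda>y. N * (1 / y)) has_integral N * ln e - N * ln (e / d)) {e/d..e}"
      using ed by (intro fundamental_theorem_of_calculus)
        (auto intro!: derivative_eq_intros simp: has_real_derivative_iff_has_vector_derivative[symmetric])
    then have I: "((\<lambda>y. N * (1 / y)) has_integral N * ln d) {e/d..e}"
      using d e by (simp add: ln_div algebra_simps)
    have "?f y \<le> N * (1 / y)" if "y \<in> {e/d..e}" for y
    proof -
      have "0 < y" using that ed by auto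
      then have "?f y = \<bar>h (ln (e / y) / ln d)\<bar> * (1 / y)"
        by (simp add: log_profile_def abs_mult)
      then show ?thesis using N \<open>0 < y\<close> by (metis mult_right_mono less_imp_le zero_less_divide_1_iff)
    qed
    then show ?thesis by (rule has_integral_le[OF integrable_integral[OF int] I])
  qed
  finally show ?thesis by simp
qed

lemma mollifier_eq_log_profile:
  "mollifier \<phi> d e = log_profile d e (\<lambda>r. \<phi> r / (2 * ln d)) 1"
  by (auto simp: mollifier_def log_profile_def sgn_if abs_if fun_eq_iff)

text \<open>
  The substitution \<open>y = x - z\<close> puts the dependence on \<open>x\<close> into the smooth factor.
\<close>
lemma mollified_kernel_eq_convolution:
  assumes "0 < e" "1 < a" and cont: "continuous_on UNIV (mollifier \<phi> d e)"
    and supp: "\<And>y. y \<notin> {-e<..<e} \<Longrightarrow> mollifier \<phi> d e y = 0"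
  shows "mollified_kernel a \<phi> d e = convolution (\<lambda>z. \<bar>z\<bar> powr (a - 1)) (mollifier \<phi> d e)"
proof
  fix x
  let ?h = "\<lambda>z. \<bar>z\<bar> powr (a - 1) * mollifier \<phi> d e (x - z)"
  have "continuous_on {x - e..x + e} ?h"
    using assms by (intro continuous_intros continuous_abs_powr continuous_on_compose2[OF cont]) auto
  then have "set_integrable lborel {x - e..x + e} ?h" by (rule borel_integrable_atLeastAtMost')
  moreover have "indicator {x - e..x + e} z *\<^sub>R ?h z = ?h z" for z
    using supp[of "x - z"] by (cases "x - z \<in> {-e<..<e}") (auto simp: indicator_def)
  ultimately have "integrable lborel ?h" by (simp only: set_integrable_def)
  then have "integral UNIV ?h = (LINT z|lborel. ?h z)" by (rule integral_lborel)
  moreover have "mollified_kernel a \<phi> d e x = (LINT z|lborel. ?h z)"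
    unfolding mollified_kernel_def by (subst lborel_integral_real_affine[of "-1" _ x]) auto
  ultimately show "mollified_kernel a \<phi> d e x = convolution (\<lambda>z. \<bar>z\<bar> powr (a - 1)) (mollifier \<phi> d e) x"
    by (simp add: convolution_def)
qed

text \<open>
  The quantitative properties of the mollifier that the estimates need. The constant \<open>N\<close> is the same for
  all \<open>d\<close> and \<open>e\<close>; the factors \<open>1 / ln d\<close> and \<open>d / e\<close> in the suprema display the whole dependence on them.
\<close>
definition scaled_bump ::
  "real \<Rightarrow> real \<Rightarrow> real \<Rightarrow> (real \<Rightarrow> real) \<Rightarrow> (real \<Rightarrow> real) \<Rightarrow> (real \<Rightarrow> real) \<Rightarrow> bool" where
  "scaled_bump N d e g g' g'' \<longleftrightarrow>
     (\<forall>y. (g has_real_derivative g' y) (at y)) \<and>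
     (\<forall>y. (g' has_real_derivative g'' y) (at y)) \<and> continuous_on UNIV g'' \<and>
     (\<forall>y. y \<notin> {-e<..<e} \<longrightarrow> g y = 0 \<and> g' y = 0 \<and> g'' y = 0) \<and>
     (\<forall>y. \<bar>g y\<bar> \<le> N / (2 * ln d) * (d / e)) \<and>
     (\<forall>y. \<bar>g' y\<bar> \<le> N / (2 * ln d) * (d / e)\<^sup>2) \<and>
     integral {-e..e} (\<lambda>y. \<bar>g y\<bar>) \<le> N"

text \<open>
  With \<open>N0\<close> and \<open>N1\<close> bounds for \<open>\<phi>\<close> and its derivative, the constant \<open>N0 + 2 * N1\<close> works: the profile of
  the derivative of the mollifier is \<open>- (\<phi> + \<phi>' / ln d) / (2 * ln d)\<close>, and \<open>1 / ln d \<le> 2\<close> for \<open>d \<ge> 2\<close>.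
\<close>
lemma mollifier_scaled_bump:
  fixes \<phi> :: "real \<Rightarrow> real"
  assumes "\<phi> \<in> test_functions {0<..<1}"
  shows "\<exists>N\<ge>0. \<forall>d\<ge>2. \<forall>e>0. \<exists>g' g''. scaled_bump N d e (mollifier \<phi> d e) g' g''"
proof -
  define f where "f k = (deriv ^^ k) \<phi>" for k
  have f: "(f k has_real_derivative f (Suc k) r) (at r)" for k r
    unfolding f_def by (rule test_function_has_derivatives[OF assms])
  have f0: "f k r = 0" if "r \<notin> {0<..<1}" for k r
    unfolding f_def using assms that by (rule test_function_vanishes)
  obtain N0 where N0: "\<bar>f 0 r\<bar> \<le> N0" for r
    using test_function_bounded[OF assms, of 0] unfolding f_def by metis
  obtain N1 where N1: "\<bar>f 1 r\<bar> \<le> N1" for r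
    using test_function_bounded[OF assms, of 1] unfolding f_def by metis
  have pos: "0 \<le> N0" "0 \<le> N1" using N0[of 0] N1[of 0] by auto
  show ?thesis
  proof (intro exI[of _ "N0 + 2 * N1"] conjI allI impI)
    show "0 \<le> N0 + 2 * N1" using pos by simp
    fix d e :: real assume d2: "2 \<le> d" and e: "0 < e"
    define L where "L = ln d"
    have d: "1 < d" using d2 by simp
    have "(1::real) / 2 \<le> ln 2" using ln_le_minus_one[of "1 / 2"] by (simp add: ln_div)
    also have "\<dots> \<le> L" using d2 by (simp add: L_def)
    finally have L: "1 / 2 \<le> L" .
    \<comment> \<open>\<open>h0\<close>, \<open>h1\<close>, \<open>h2\<close> are the profiles of the mollifier and of its first two derivatives; primes are
      derivatives in \<open>r\<close>, and \<open>h0_3\<close> is the third one. The third derivative of \<open>\<phi>\<close> enters through the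
      differentiability, hence continuity, of the profile \<open>h2\<close>.\<close>
    define h0 h0' h0'' h0_3 where "h0 r = f 0 r / (2 * L)" and "h0' r = f 1 r / (2 * L)"
      and "h0'' r = f 2 r / (2 * L)" and "h0_3 r = f 3 r / (2 * L)" for r
    define h1 h1' h1'' where "h1 r = - (real 1 * h0 r + h0' r / L)"
      and "h1' r = - (real 1 * h0' r + h0'' r / L)"
      and "h1'' r = - (real 1 * h0'' r + h0_3 r / L)" for r
    define h2 h2' where "h2 r = - (real 2 * h1 r + h1' r / L)"
      and "h2' r = - (real 2 * h1' r + h1'' r / L)" for r
    have h0: "(h0 has_real_derivative h0' r) (at r)" "(h0' has_real_derivative h0'' r) (at r)"
      "(h0'' has_real_derivative h0_3 r) (at r)" for r
      using DERIV_cdivide[OF f[of 0 r], of "2 * L"] DERIV_cdivide[OF f[of 1 r], of "2 * L"]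
        DERIV_cdivide[OF f[of 2 r], of "2 * L"]
      by (simp_all add: h0_def[abs_def] h0'_def[abs_def] h0''_def[abs_def] h0_3_def[abs_def]
        numeral_2_eq_2 numeral_3_eq_3)
    have h1: "(h1 has_real_derivative h1' r) (at r)" "(h1' has_real_derivative h1'' r) (at r)" for r
      unfolding h1_def[abs_def] h1'_def[abs_def] h1''_def[abs_def]
      by (intro DERIV_minus DERIV_add DERIV_cmult DERIV_cdivide h0)+
    have h2: "(h2 has_real_derivative h2' r) (at r)" for r
      unfolding h2_def[abs_def] h2'_def[abs_def]
      by (intro DERIV_minus DERIV_add DERIV_cmult DERIV_cdivide h1)
    have supp: "h0 r = 0" "h1 r = 0" "h2 r = 0" if "r \<notin> {0<..<1}" for r
      using f0[OF that] by (simp_all add: h0_def h0'_def h0''_def h1_def h1'_def h2_def)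
    let ?g' = "log_profile d e h1 2" and ?g'' = "log_profile d e h2 3"
    have mol: "mollifier \<phi> d e = log_profile d e h0 1"
      by (simp add: mollifier_eq_log_profile h0_def[abs_def] f_def L_def)
    have "(log_profile d e h0 1 has_real_derivative log_profile d e h1 (Suc 1) y) (at y)" for y
      unfolding h1_def[abs_def] L_def by (intro log_profile_has_derivative d e h0 supp)
    then have g: "(mollifier \<phi> d e has_real_derivative ?g' y) (at y)" for y
      by (simp add: mol numeral_2_eq_2)
    have "(?g' has_real_derivative log_profile d e h2 (Suc 2) y) (at y)" for y
      unfolding h2_def[abs_def] L_def by (intro log_profile_has_derivative d e h1 supp)
    then have g': "(?g' has_real_derivative ?g'' y) (at y)" for y
      by (simp add: numeral_3_eq_3 numeral_2_eq_2)
    have g'': "continuous_on UNIV ?g''"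
      by (intro continuous_at_imp_continuous_on ballI
        DERIV_isCont[OF log_profile_has_derivative[where h' = h2']] d e h2 supp)
    have B0: "\<bar>h0 r\<bar> \<le> N0 / (2 * L)" for r
      using N0[of r] L by (simp add: h0_def divide_right_mono)
    have B1: "\<bar>h1 r\<bar> \<le> (N0 + 2 * N1) / (2 * L)" for r
    proof -
      have "1 / L \<le> 2" using L by (simp add: field_simps)
      then have "\<bar>f 1 r\<bar> * (1 / L) \<le> N1 * 2" using N1 pos L by (intro mult_mono) auto
      then have "\<bar>f 0 r + f 1 r / L\<bar> \<le> N0 + 2 * N1"
        using N0[of r] L abs_triangle_ineq[of "f 0 r" "f 1 r / L"] by simp
      moreover have "h1 r = - ((f 0 r + f 1 r / L) / (2 * L))"
        using L by (simp add: h1_def h0_def h0'_def field_simps)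
      ultimately show ?thesis using L by (simp add: divide_right_mono)
    qed
    show "\<exists>g' g''. scaled_bump (N0 + 2 * N1) d e (mollifier \<phi> d e) g' g''"
      unfolding scaled_bump_def
    proof (rule exI[of _ ?g'], rule exI[of _ ?g''], intro conjI allI impI g g' g'')
      fix y
      assume "y \<notin> {-e<..<e}"
      then have y: "\<bar>y\<bar> \<le> e / d \<or> e \<le> \<bar>y\<bar>" by auto
      show "mollifier \<phi> d e y = 0" "?g' y = 0" "?g'' y = 0"
        unfolding mol by (rule log_profile_vanishes[OF d e _ y], rule supp, assumption)+
    next
      fix y
      have "\<bar>h0 r\<bar> \<le> (N0 + 2 * N1) / (2 * L)" for r
        using B0[of r] pos L divide_right_mono[of N0 "N0 + 2 * N1" "2 * L"] by simp
      then have "\<bar>log_profile d e h0 1 y\<bar> \<le> (N0 + 2 * N1) / (2 * L) * (d / e) ^ 1"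
        by (intro log_profile_bound d e supp)
      then show "\<bar>mollifier \<phi> d e y\<bar> \<le> (N0 + 2 * N1) / (2 * ln d) * (d / e)"
        by (simp add: mol L_def)
      show "\<bar>?g' y\<bar> \<le> (N0 + 2 * N1) / (2 * ln d) * (d / e)\<^sup>2"
        unfolding L_def[symmetric] by (intro log_profile_bound d e supp B1)
    next
      have "continuous_on UNIV (log_profile d e h0 1)"
        unfolding mol[symmetric]
        by (intro continuous_at_imp_continuous_on ballI DERIV_isCont[OF g])
      then have "integral {-e..e} (\<lambda>y. \<bar>log_profile d e h0 1 y\<bar>) \<le> 2 * (N0 / (2 * L)) * ln d"
        by (intro log_profile_mass d e supp B0)
      then have "integral {-e..e} (\<lambda>y. \<bar>mollifier \<phi> d e y\<bar>) \<le> 2 * (N0 / (2 * L)) * L"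
        by (simp only: mol L_def)
      also have "\<dots> \<le> N0 + 2 * N1" using L pos by simp
      finally show "integral {-e..e} (\<lambda>y. \<bar>mollifier \<phi> d e y\<bar>) \<le> N0 + 2 * N1" .
    qed
  qed
qed

section \<open>The estimates for the mollified kernel\<close>

text \<open>
  Here \<open>v\<close> stands for the absolute value of the \<open>m\<close>-th derivative at \<open>x\<close>, which far from the origin
  is of the order of the \<open>m\<close>-th derivative of the kernel, with exponent \<open>p - m = - q\<close>. In the weighted
  bound the near region contributes \<open>(2 * e) ^ m \<le> 4 * e ^ m\<close>, which explains the factor \<open>4\<close>. For the
  uniform bound the far region is dominated by the near one because \<open>\<bar>x\<bar> powr (-q)\<close> decreases and
  \<open>ln d \<le> d ^ m\<close>.
\<close>
lemma combine_near_far: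
  fixes d e p q v x C :: real and m :: nat
  assumes d: "2 \<le> d" and e: "0 < e" and m: "1 \<le> m" "m \<le> 2" and q: "0 \<le> q" "p + q = real m"
    and v: "0 \<le> v" and C: "0 \<le> C"
    and far: "2 * e < \<bar>x\<bar> \<Longrightarrow> v \<le> C * \<bar>x\<bar> powr (-q)"
    and near: "\<bar>x\<bar> \<le> 2 * e \<Longrightarrow> v \<le> C * (d ^ m / (e powr q * ln d))"
  shows "v \<le> 4 * C * (\<bar>x\<bar> powr (-q) * of_bool (\<bar>x\<bar> > 2 * e)
            + d ^ m / (e powr q * ln d) * of_bool (\<bar>x\<bar> \<le> 2 * e))" (is ?pw)
    and "v * \<bar>x\<bar> ^ m \<le> 4 * C * (\<bar>x\<bar> powr p + d ^ m / ln d * e powr p)" (is ?wt)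
    and "v \<le> 4 * C * (d ^ m / (e powr q * ln d))" (is ?un)
proof -
  have ln: "0 < ln d" using d by simp
  have T: "0 \<le> d ^ m / (e powr q * ln d)" using d ln by simp
  have p: "p = real m - q" using q by simp
  have em: "e ^ m / e powr q = e powr p" using e by (simp add: p powr_diff powr_realpow)
  show ?pw
  proof (cases "2 * e < \<bar>x\<bar>")
    case True
    then have "v \<le> C * \<bar>x\<bar> powr (-q)" by (rule far)
    also have "\<dots> \<le> 4 * (C * \<bar>x\<bar> powr (-q))" using C by simp
    finally show ?thesis using True by simp
  next
    case False
    then have "v \<le> C * (d ^ m / (e powr q * ln d))" by (intro near) simp
    also have "\<dots> \<le> 4 * (C * (d ^ m / (e powr q * ln d)))" using C T mult_nonneg_nonneg[OF C T] by linarith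
    finally show ?thesis using False by (simp add: mult.assoc)
  qed
  show ?wt
  proof (cases "2 * e < \<bar>x\<bar>")
    case True
    then have x: "0 < \<bar>x\<bar>" using e by linarith
    have "v * \<bar>x\<bar> ^ m \<le> C * \<bar>x\<bar> powr (-q) * \<bar>x\<bar> ^ m" using far[OF True] by (intro mult_right_mono) auto
    also have "\<bar>x\<bar> powr (-q) * \<bar>x\<bar> ^ m = \<bar>x\<bar> powr p"
      using x by (simp add: p powr_diff powr_realpow powr_minus_divide)
    then have "C * \<bar>x\<bar> powr (-q) * \<bar>x\<bar> ^ m = C * \<bar>x\<bar> powr p" by (simp add: mult.assoc)
    also have "\<dots> \<le> 4 * C * (\<bar>x\<bar> powr p + d ^ m / ln d * e powr p)"
      using C d ln by (intro mult_mono) auto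
    finally show ?thesis .
  next
    case False
    have "v * \<bar>x\<bar> ^ m \<le> C * (d ^ m / (e powr q * ln d)) * (2 * e) ^ m"
      using False near v T C by (intro mult_mono power_mono) auto
    also have "\<dots> = 2 ^ m * (C * (d ^ m / ln d * (e ^ m / e powr q)))"
      by (simp add: power_mult_distrib mult_ac)
    also have "\<dots> \<le> 4 * (C * (d ^ m / ln d * e powr p))"
    proof (intro mult_mono)
      have "(2::real) ^ m \<le> 2 ^ 2" using m by (intro power_increasing) auto
      then show "(2::real) ^ m \<le> 4" by simp
    qed (use em C d ln in auto)
    also have "\<dots> \<le> 4 * C * (\<bar>x\<bar> powr p + d ^ m / ln d * e powr p)"
      using C by (simp only: distrib_left mult.assoc) simp
    finally show ?thesis .
  qed
  show ?un
  proof (cases "2 * e < \<bar>x\<bar>")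
    case True
    have "ln d \<le> d ^ 1" using ln_bound[of d] d by simp
    also have "\<dots> \<le> d ^ m" using d m by (intro power_increasing) auto
    finally have dm: "1 \<le> d ^ m / ln d" using ln by simp
    have "\<bar>x\<bar> powr (-q) \<le> e powr (-q)" using True e q by (intro powr_mono2') auto
    also have "\<dots> \<le> e powr (-q) * (d ^ m / ln d)" using dm mult_left_mono[OF dm, of "e powr (-q)"] by simp
    also have "\<dots> = d ^ m / (e powr q * ln d)" by (simp add: powr_minus_divide)
    finally have "C * \<bar>x\<bar> powr (-q) \<le> C * (d ^ m / (e powr q * ln d))" using C by (rule mult_left_mono)
    then have "v \<le> C * (d ^ m / (e powr q * ln d))" using far[OF True] by linarith
    then show ?thesis using mult_nonneg_nonneg[OF C T] by (simp only: mult.assoc)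
  next
    case False
    then have "v \<le> C * (d ^ m / (e powr q * ln d))" by (intro near) simp
    then show ?thesis using mult_nonneg_nonneg[OF C T] by (simp only: mult.assoc)
  qed
qed

lemma uniform_norm_le: "(\<And>x. \<bar>f x\<bar> \<le> B) \<Longrightarrow> uniform_norm f \<le> ereal B"
  unfolding uniform_norm_def by (intro SUP_least) simp

theorem proposition6p4:
  fixes \<alpha> :: real and \<phi> :: "real \<Rightarrow> real"
  assumes "1 < \<alpha>" and "\<alpha> < 2"
    and "\<phi> \<in> test_functions {0<..<1}"
    and "\<And>r. \<phi> r \<ge> 0"
    and "(LINT r:{0<..<1}|lborel. \<phi> r) = 1"
  shows "\<exists>C>0. \<forall>\<delta>\<ge>2. \<forall>\<epsilon>\<in>{0<..<1}.
     (\<forall>x. mollified_kernel \<alpha> \<phi> \<delta> \<epsilon> differentiable at x \<and>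
          deriv (mollified_kernel \<alpha> \<phi> \<delta> \<epsilon>) differentiable at x \<and>
          \<bar>deriv (mollified_kernel \<alpha> \<phi> \<delta> \<epsilon>) x\<bar>
            \<le> C * (\<bar>x\<bar> powr (\<alpha> - 2) * of_bool (\<bar>x\<bar> > 2 * \<epsilon>)
                 + \<delta> / (\<epsilon> powr (2 - \<alpha>) * ln \<delta>) * of_bool (\<bar>x\<bar> \<le> 2 * \<epsilon>)) \<and>
          \<bar>deriv (mollified_kernel \<alpha> \<phi> \<delta> \<epsilon>) x\<bar> * \<bar>x\<bar>
            \<le> C * (\<bar>x\<bar> powr (\<alpha> - 1) + \<delta> / ln \<delta> * \<epsilon> powr (\<alpha> - 1)) \<and>
          \<bar>deriv (deriv (mollified_kernel \<alpha> \<phi> \<delta> \<epsilon>)) x\<bar>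
            \<le> C * (\<bar>x\<bar> powr (\<alpha> - 3) * of_bool (\<bar>x\<bar> > 2 * \<epsilon>)
                 + \<delta>\<^sup>2 / (\<epsilon> powr (3 - \<alpha>) * ln \<delta>) * of_bool (\<bar>x\<bar> \<le> 2 * \<epsilon>)) \<and>
          \<bar>deriv (deriv (mollified_kernel \<alpha> \<phi> \<delta> \<epsilon>)) x\<bar> * x\<^sup>2
            \<le> C * (\<bar>x\<bar> powr (\<alpha> - 1) + \<delta>\<^sup>2 / ln \<delta> * \<epsilon> powr (\<alpha> - 1))) \<and>
     uniform_norm (deriv (mollified_kernel \<alpha> \<phi> \<delta> \<epsilon>))
       \<le> ereal (C * (\<delta> / (\<epsilon> powr (2 - \<alpha>) * ln \<delta>))) \<and>
     uniform_norm (deriv (deriv (mollified_kernel \<alpha> \<phi> \<delta> \<epsilon>)))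
       \<le> ereal (C * (\<delta>\<^sup>2 / (\<epsilon> powr (3 - \<alpha>) * ln \<delta>)))"
proof -
  obtain N where N: "0 \<le> N"
    and mol: "\<And>\<delta> \<epsilon>. 2 \<le> \<delta> \<Longrightarrow> 0 < \<epsilon> \<Longrightarrow> \<exists>g' g''. scaled_bump N \<delta> \<epsilon> (mollifier \<phi> \<delta> \<epsilon>) g' g''"
    using mollifier_scaled_bump[OF assms(3)] by blast
  \<comment> \<open>The summand \<open>1\<close> keeps the constant positive when \<open>N = 0\<close>.\<close>
  define K where "K = 4 * N + 1"
  define p where "p = \<alpha> - 1"
  have p: "0 < p" "p < 1" using assms by (auto simp: p_def)
  have K: "0 \<le> K" "2 * N \<le> K" "3 * N \<le> K" "4 * N \<le> K" using N by (auto simp: K_def)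
  show ?thesis
  proof (intro exI[of _ "4 * K"] conjI allI impI ballI)
    show "4 * K > 0" using N by (simp add: K_def)
    fix \<delta> \<epsilon> :: real assume \<delta>: "2 \<le> \<delta>" and "\<epsilon> \<in> {0<..<1}"
    then have \<epsilon>: "0 < \<epsilon>" by simp
    have ln: "0 < ln \<delta>" using \<delta> by simp
    let ?g = "mollifier \<phi> \<delta> \<epsilon>" and ?k = "\<lambda>z::real. \<bar>z\<bar> powr p"
    from mol[OF \<delta> \<epsilon>] obtain g' g'' where g: "\<And>y. (?g has_real_derivative g' y) (at y)"
      and g': "\<And>y. (g' has_real_derivative g'' y) (at y)" and g'': "continuous_on UNIV g''"
      and supp: "\<And>y. y \<notin> {-\<epsilon><..<\<epsilon>} \<Longrightarrow> ?g y = 0" "\<And>y. y \<notin> {-\<epsilon><..<\<epsilon>} \<Longrightarrow> g' y = 0"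
        "\<And>y. y \<notin> {-\<epsilon><..<\<epsilon>} \<Longrightarrow> g'' y = 0"
      and sup: "\<And>y. \<bar>?g y\<bar> \<le> N / (2 * ln \<delta>) * (\<delta> / \<epsilon>)" "\<And>y. \<bar>g' y\<bar> \<le> N / (2 * ln \<delta>) * (\<delta> / \<epsilon>)\<^sup>2"
      and mass: "integral {-\<epsilon>..\<epsilon>} (\<lambda>y. \<bar>?g y\<bar>) \<le> N"
      unfolding scaled_bump_def by blast
    have cont: "continuous_on UNIV ?g" "continuous_on UNIV g'"
      using g g' by (meson DERIV_isCont continuous_at_imp_continuous_on)+
    define u where "u = mollified_kernel \<alpha> \<phi> \<delta> \<epsilon>"
    have u: "u = convolution ?k ?g"
      unfolding u_def p_def using \<epsilon> assms(1) cont(1) supp(1) by (intro mollified_kernel_eq_convolution)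
    have du: "(u has_real_derivative convolution ?k g' x) (at x)" for x
      unfolding u using supp by (intro convolution_has_derivative[where e = \<epsilon>] continuous_abs_powr p g cont) auto
    have ddu: "(convolution ?k g' has_real_derivative convolution ?k g'' x) (at x)" for x
      using supp by (intro convolution_has_derivative[where e = \<epsilon>] continuous_abs_powr p g' g'') auto
    have u': "deriv u = convolution ?k g'" using DERIV_imp_deriv[OF du] by (rule ext)
    have u'': "deriv (deriv u) = convolution ?k g''"
      unfolding u' using DERIV_imp_deriv[OF ddu] by (rule ext)
    have far1: "\<bar>deriv u x\<bar> \<le> K * \<bar>x\<bar> powr (-(2 - \<alpha>))" if "2 * \<epsilon> < \<bar>x\<bar>" for x
    proof -
      have "\<bar>deriv u x\<bar> \<le> 2 * N * \<bar>x\<bar> powr (p - 1)"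
        unfolding u' by (rule convolution_powr_far_bound[OF p \<epsilon> g cont(2) supp(1,2) mass that])
      also have "\<dots> \<le> K * \<bar>x\<bar> powr (p - 1)" using K by (intro mult_right_mono) auto
      finally show ?thesis by (simp add: p_def)
    qed
    have far2: "\<bar>deriv (deriv u) x\<bar> \<le> K * \<bar>x\<bar> powr (-(3 - \<alpha>))" if "2 * \<epsilon> < \<bar>x\<bar>" for x
    proof -
      have "\<bar>deriv (deriv u) x\<bar> \<le> 4 * N * \<bar>x\<bar> powr (p - 2)"
        unfolding u'' by (rule convolution_powr_far_bound_second[OF p \<epsilon> g g' g'' supp mass that])
      also have "\<dots> \<le> K * \<bar>x\<bar> powr (p - 2)" using K by (intro mult_right_mono) auto
      finally show ?thesis by (simp add: p_def)
    qed
    have scale: "6 * (N / (2 * ln \<delta>) * (\<delta> / \<epsilon>) ^ m) * \<epsilon> powr p \<le> K * (\<delta> ^ m / (\<epsilon> powr q * ln \<delta>))"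
      if "p + q = real m" for m q
    proof -
      have "p = real m - q" using that by simp
      then have "\<epsilon> powr p = \<epsilon> ^ m / \<epsilon> powr q" using \<epsilon> by (simp add: powr_diff powr_realpow)
      then have "6 * (N / (2 * ln \<delta>) * (\<delta> / \<epsilon>) ^ m) * \<epsilon> powr p = 3 * N * (\<delta> ^ m / (\<epsilon> powr q * ln \<delta>))"
        using \<epsilon> by (simp add: power_divide mult_ac)
      also have "\<dots> \<le> K * (\<delta> ^ m / (\<epsilon> powr q * ln \<delta>))"
        using K ln \<delta> by (intro mult_right_mono) auto
      finally show ?thesis .
    qed
    have near1: "\<bar>deriv u x\<bar> \<le> K * (\<delta> ^ 1 / (\<epsilon> powr (2 - \<alpha>) * ln \<delta>))" if "\<bar>x\<bar> \<le> 2 * \<epsilon>" for x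
    proof -
      have "\<bar>deriv u x\<bar> \<le> 6 * (N / (2 * ln \<delta>) * (\<delta> / \<epsilon>)) * \<epsilon> powr p"
        unfolding u' by (rule convolution_powr_near_bound[OF p \<epsilon> g cont(2) supp(1,2) sup(1) that])
      also have "\<dots> \<le> K * (\<delta> ^ 1 / (\<epsilon> powr (2 - \<alpha>) * ln \<delta>))"
        using scale[of "2 - \<alpha>" 1] by (simp add: p_def)
      finally show ?thesis .
    qed
    have near2: "\<bar>deriv (deriv u) x\<bar> \<le> K * (\<delta>\<^sup>2 / (\<epsilon> powr (3 - \<alpha>) * ln \<delta>))" if "\<bar>x\<bar> \<le> 2 * \<epsilon>" for x
    proof -
      have "\<bar>deriv (deriv u) x\<bar> \<le> 6 * (N / (2 * ln \<delta>) * (\<delta> / \<epsilon>)\<^sup>2) * \<epsilon> powr p"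
        unfolding u'' by (rule convolution_powr_near_bound[OF p \<epsilon> g' g'' supp(2,3) sup(2) that])
      also have "\<dots> \<le> K * (\<delta>\<^sup>2 / (\<epsilon> powr (3 - \<alpha>) * ln \<delta>))"
        using scale[of "3 - \<alpha>" 2] by (simp add: p_def)
      finally show ?thesis .
    qed
    have q1: "(1::nat) \<le> 1" "(1::nat) \<le> 2" "0 \<le> 2 - \<alpha>" "\<alpha> - 1 + (2 - \<alpha>) = real 1" using assms by auto
    have q2: "(1::nat) \<le> 2" "(2::nat) \<le> 2" "0 \<le> 3 - \<alpha>" "\<alpha> - 1 + (3 - \<alpha>) = real 2" using assms by auto
    note first = combine_near_far[OF \<delta> \<epsilon> q1 abs_ge_zero K(1) far1 near1]
    note second = combine_near_far[OF \<delta> \<epsilon> q2 abs_ge_zero K(1) far2 near2]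
    show "mollified_kernel \<alpha> \<phi> \<delta> \<epsilon> differentiable at x" for x
      using du[of x] unfolding u_def by (auto simp: real_differentiable_def)
    show "deriv (mollified_kernel \<alpha> \<phi> \<delta> \<epsilon>) differentiable at x" for x
      using ddu[of x] u' unfolding u_def by (auto simp: real_differentiable_def)
    show "\<bar>deriv (mollified_kernel \<alpha> \<phi> \<delta> \<epsilon>) x\<bar>
            \<le> 4 * K * (\<bar>x\<bar> powr (\<alpha> - 2) * of_bool (\<bar>x\<bar> > 2 * \<epsilon>)
                 + \<delta> / (\<epsilon> powr (2 - \<alpha>) * ln \<delta>) * of_bool (\<bar>x\<bar> \<le> 2 * \<epsilon>))" for x
      using first(1)[of x] by (simp add: u_def)
    show "\<bar>deriv (mollified_kernel \<alpha> \<phi> \<delta> \<epsilon>) x\<bar> * \<bar>x\<bar> \<le> 4 * K * (\<bar>x\<bar> powr (\<alpha> - 1) + \<delta> / ln \<delta> * \<epsilon> powr (\<alpha> - 1))" for x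
      using first(2)[of x] by (simp add: u_def)
    show "\<bar>deriv (deriv (mollified_kernel \<alpha> \<phi> \<delta> \<epsilon>)) x\<bar>
            \<le> 4 * K * (\<bar>x\<bar> powr (\<alpha> - 3) * of_bool (\<bar>x\<bar> > 2 * \<epsilon>)
                 + \<delta>\<^sup>2 / (\<epsilon> powr (3 - \<alpha>) * ln \<delta>) * of_bool (\<bar>x\<bar> \<le> 2 * \<epsilon>))" for x
      using second(1)[of x] by (simp add: u_def)
    show "\<bar>deriv (deriv (mollified_kernel \<alpha> \<phi> \<delta> \<epsilon>)) x\<bar> * x\<^sup>2 \<le> 4 * K * (\<bar>x\<bar> powr (\<alpha> - 1) + \<delta>\<^sup>2 / ln \<delta> * \<epsilon> powr (\<alpha> - 1))" for x
      using second(2)[of x] by (simp add: u_def)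
    show "uniform_norm (deriv (mollified_kernel \<alpha> \<phi> \<delta> \<epsilon>)) \<le> ereal (4 * K * (\<delta> / (\<epsilon> powr (2 - \<alpha>) * ln \<delta>)))"
      using first(3) by (intro uniform_norm_le) (simp add: u_def)
    show "uniform_norm (deriv (deriv (mollified_kernel \<alpha> \<phi> \<delta> \<epsilon>))) \<le> ereal (4 * K * (\<delta>\<^sup>2 / (\<epsilon> powr (3 - \<alpha>) * ln \<delta>)))"
      using second(3) by (intro uniform_norm_le) (simp add: u_def)
  qed
qed

end
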